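(* Let $\mathbb{F}$ be an infinite field of characteristic $p=2$. The following set is an $\mathbb{F}$-basis of the space of all polynomial identities for $\mathsf{A}_1^{(-,1)}$ of multidegree $(1,1,1,1)$ (in the variables $x_1,x_2,x_3,x_4$): $$\Gamma,\; \Psi,\;\Delta,\;\Lambda, \; x_1\mathrm{St}_3(x_2,x_3,x_4), \; x_2\mathrm{St}_3(x_1,x_3,x_4), \; x_3\mathrm{St}_3(x_1,x_2,x_4), \; x_4\mathrm{St}_3(x_1,x_2,x_3),$$ $$\mathrm{St}_3(x_2,x_3,x_4)x_1,\; \mathrm{St}_3(x_1,x_3,x_4)x_2,\; \mathrm{St}_3(x_1,x_2,x_4)x_3,\; [[x_1,x_3],[x_2,x_4]].$$
   Context: $\mathbb{F}\langle X\rangle$ is the free unital associative $\mathbb{F}$-algebra on $X=\{x_1,x_2,\dots\}$, and $[a,b]=ab-ba$. The Weyl algebra $\mathsf{A}_1$ is the unital associative $\mathbb{F}$-algebra generated by $x,y$ with defining relation $yx=xy+1$, and $\mathsf{A}_1^{(-,1)}\subset\mathsf{A}_1$ is the $\mathbb{F}$-linear span of all elements $ay$ with $a\in\mathbb{F}[x]$. An element $f(x_1,\dots,x_m)\in\mathbb{F}\langle X\rangle$ is a polynomial identity for a subspace $\mathcal{V}$ of an associative algebra $\mathcal{A}$ if $f(a_1,\dots,a_m)=0$ in $\mathcal{A}$ for all $a_1,\dots,a_m\in\mathcal{V}$. An element of multidegree $(1,1,1,1)$ is a linear combination of the monomials $x_{\sigma(1)}x_{\sigma(2)}x_{\sigma(3)}x_{\sigma(4)}$,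 $\sigma\in S_4$. The standard polynomial is $\mathrm{St}_3(z_1,z_2,z_3)=\sum_{\sigma\in S_3}(-1)^{\sigma}z_{\sigma(1)}z_{\sigma(2)}z_{\sigma(3)}$. Further, $$\begin{aligned}\Gamma={}& -x_1 x_2 x_3 x_4 + 2 x_1 x_2 x_4 x_3 + x_1 x_3 x_4 x_2 - 2 x_1 x_4 x_2 x_3\\ & + 2 x_2 x_1 x_3 x_4 - 2 x_2 x_1 x_4 x_3 - 2 x_2 x_3 x_1 x_4 + x_2 x_3 x_4 x_1 + x_2 x_4 x_1 x_3\\ & + x_3 x_1 x_2 x_4 - 2 x_3 x_1 x_4 x_2 + x_3 x_4 x_1 x_2 + x_4 x_1 x_2 x_3 - x_4 x_2 x_3 x_1,\\ \Psi={}& x_2[x_1,x_4]x_3 + x_3[x_1,x_4]x_2,\\ \Delta={}& x_2x_1x_3x_4 + x_2x_4x_1x_3 + x_3x_1x_2x_4 + x_3x_4x_1x_2 + x_4x_1x_2x_3 + x_4x_1x_3x_2,\\ \Lambda={}& -3 x_1 x_2 x_3 x_4 + 3 x_1 x_2 x_4 x_3 + 2 x_1 x_3 x_2 x_4 - 2 x_1 x_4 x_2 x_3\\ & + 3 x_2 x_1 x_3 x_4 - 3 x_2 x_1 x_4 x_3 - 2 x_2 x_3 x_1 x_4 + 2 x_2 x_4 x_1 x_3\\ & - x_3 x_1 x_4 x_2 + x_3 x_2 x_4 x_1 + x_4 x_1 x_3 x_2 - x_4 x_2 x_3 x_1.\end{aligned}$$ *)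

theory Defs
  imports
    "HOL-Library.Poly_Mapping"
    "HOL-Combinatorics.Permutations"
    "HOL-Computational_Algebra.Polynomial"
begin

section \<open>Free associative algebras\<close>

text \<open>
  The free unital associative algebra on a set of letters is the monoid algebra of the free
  monoid. The multiplication that \<^theory>\<open>HOL-Library.Poly_Mapping\<close> puts on finitely supported
  functions is convolution with respect to the addition of the keys, so the free
  monoid is written additively: the sum of two words is their concatenation.
\<close>

datatype 'v word = Word (letters: "'v list")

instantiation word :: (type) monoid_add
begin

definition zero_word :: "'a word" where "0 = Word []"

definition plus_word :: "'a word \<Rightarrow> 'a word \<Rightarrow> 'a word"
  where "u + v = Word (letters u @ letters v)"

instance
  by standard (simp_all add: zero_word_def plus_word_def)

end

type_synonym ('v, 'f) free_algebra = "'v word \<Rightarrow>\<^sub>0 'f"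

definition letter :: "'v \<Rightarrow> ('v, 'f::field) free_algebra"
  where "letter v = Poly_Mapping.single (Word [v]) 1"

definition free_scale :: "'f::field \<Rightarrow> ('v, 'f) free_algebra \<Rightarrow> ('v, 'f) free_algebra"
  where "free_scale c f = Poly_Mapping.map ((*) c) f"

lemma lookup_free_scale [simp]:
  "Poly_Mapping.lookup (free_scale c f) w = c * Poly_Mapping.lookup f w"
  by (simp add: free_scale_def Poly_Mapping.map.rep_eq when_def)

lemma free_scale_single:
  "free_scale c (Poly_Mapping.single w d) = Poly_Mapping.single w (c * d)"
  by (rule poly_mapping_eqI) (simp add: lookup_single when_def)

lemma free_algebra_induct [case_names single sum]:
  assumes single: "\<And>w c. P (Poly_Mapping.single w c)"
    and sum: "\<And>f g. P f \<Longrightarrow> P g \<Longrightarrow> P (f + g)"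
  shows "P f"
proof (induction f rule: update_induct)
  case const
  show ?case using single[of undefined 0] by simp
next
  case (update f a b)
  have "Poly_Mapping.update a b f = f + Poly_Mapping.single a b"
    using update.hyps
    by (intro poly_mapping_eqI)
      (auto simp: lookup_update lookup_add lookup_single when_def in_keys_iff)
  with update.IH single sum show ?case by simp
qed

lemma free_scale_eq_mult: "free_scale c f = Poly_Mapping.single 0 c * f"
proof (induction f rule: free_algebra_induct)
  case (single k v)
  then show ?case by (simp add: free_scale_single mult_single)
next
  case (sum f g)
  have "free_scale c (f + g) = free_scale c f + free_scale c g"
    by (rule poly_mapping_eqI) (simp add: lookup_add algebra_simps)
  with sum show ?case by (simp add: distrib_left)
qed

lemma free_scale_eq_mult_right: "free_scale c f = f * Poly_Mapping.single 0 c"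
proof (induction f rule: free_algebra_induct)
  case (single k v)
  then show ?case by (simp add: free_scale_single mult_single mult.commute)
next
  case (sum f g)
  have "free_scale c (f + g) = free_scale c f + free_scale c g"
    by (rule poly_mapping_eqI) (simp add: lookup_add algebra_simps)
  with sum show ?case by (simp add: distrib_right)
qed


section \<open>Associative algebras and polynomial identities\<close>

locale assoc_algebra = vector_space scale
  for scale :: "'f::field \<Rightarrow> 'a::ring_1 \<Rightarrow> 'a" +
  assumes scale_mult_left: "scale c a * b = scale c (a * b)"
    and scale_mult_right: "a * scale c b = scale c (a * b)"
begin

definition eval :: "('v \<Rightarrow> 'a) \<Rightarrow> ('v, 'f) free_algebra \<Rightarrow> 'a"
  where "eval a f =
    (\<Sum>w\<in>Poly_Mapping.keys f. scale (Poly_Mapping.lookup f w) (prod_list (map a (letters w))))"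

definition polynomial_identity :: "'a set \<Rightarrow> ('v, 'f) free_algebra \<Rightarrow> bool"
  where "polynomial_identity V f \<longleftrightarrow> (\<forall>a. (\<forall>v. a v \<in> V) \<longrightarrow> eval a f = 0)"

definition is_basis_of :: "'a list \<Rightarrow> 'a set \<Rightarrow> bool"
  where "is_basis_of bs U \<longleftrightarrow> distinct bs \<and> independent (set bs) \<and> span (set bs) = U"

end

global_interpretation free: assoc_algebra
  "free_scale :: 'f::field \<Rightarrow> ('v, 'f) free_algebra \<Rightarrow> ('v, 'f) free_algebra"
proof
  show "free_scale c (f + g) = free_scale c f + free_scale c g"
    for c :: 'f and f g :: "('v, 'f) free_algebra"
    by (rule poly_mapping_eqI) (simp add: lookup_add algebra_simps)
  show "free_scale (c + d) f = free_scale c f + free_scale d f"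
    for c d :: 'f and f :: "('v, 'f) free_algebra"
    by (rule poly_mapping_eqI) (simp add: lookup_add algebra_simps)
  show "free_scale c (free_scale d f) = free_scale (c * d) f"
    for c d :: 'f and f :: "('v, 'f) free_algebra"
    by (rule poly_mapping_eqI) (simp add: algebra_simps)
  show "free_scale 1 f = f" for f :: "('v, 'f) free_algebra"
    by (rule poly_mapping_eqI) simp
  show "free_scale c f * g = free_scale c (f * g)"
    for c :: 'f and f g :: "('v, 'f) free_algebra"
    by (simp add: free_scale_eq_mult mult.assoc)
  show "f * free_scale c g = free_scale c (f * g)"
    for c :: 'f and f g :: "('v, 'f) free_algebra"
    by (simp add: free_scale_eq_mult_right mult.assoc)
qed


section \<open>The Weyl algebra\<close>

inductive_set two_sided_ideal :: "'a::ring_1 set \<Rightarrow> 'a set" for S where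
  generator: "s \<in> S \<Longrightarrow> s \<in> two_sided_ideal S"
| zero: "0 \<in> two_sided_ideal S"
| add: "a \<in> two_sided_ideal S \<Longrightarrow> b \<in> two_sided_ideal S \<Longrightarrow> a + b \<in> two_sided_ideal S"
| mult_left: "a \<in> two_sided_ideal S \<Longrightarrow> r * a \<in> two_sided_ideal S"
| mult_right: "a \<in> two_sided_ideal S \<Longrightarrow> a * r \<in> two_sided_ideal S"

lemma two_sided_ideal_uminus: "a \<in> two_sided_ideal S \<Longrightarrow> - a \<in> two_sided_ideal S"
  using two_sided_ideal.mult_left[of a S "- 1"] by simp

lemma two_sided_ideal_diff:
  "a \<in> two_sided_ideal S \<Longrightarrow> b \<in> two_sided_ideal S \<Longrightarrow> a - b \<in> two_sided_ideal S"
  using two_sided_ideal.add[OF _ two_sided_ideal_uminus, of a S b] by simp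

datatype weyl_generator = GenX | GenY

definition weyl_ideal :: "(weyl_generator, 'f::field) free_algebra set"
  where "weyl_ideal =
    two_sided_ideal {letter GenY * letter GenX - (letter GenX * letter GenY + 1)}"

definition weyl_rel ::
    "(weyl_generator, 'f::field) free_algebra \<Rightarrow> (weyl_generator, 'f) free_algebra \<Rightarrow> bool"
  where "weyl_rel f g \<longleftrightarrow> f - g \<in> weyl_ideal"

lemma weyl_rel_add: "weyl_rel f f' \<Longrightarrow> weyl_rel g g' \<Longrightarrow> weyl_rel (f + g) (f' + g')"
  using two_sided_ideal.add[of "f - f'" _ "g - g'"]
  by (simp add: weyl_rel_def weyl_ideal_def algebra_simps)

lemma weyl_rel_uminus: "weyl_rel f f' \<Longrightarrow> weyl_rel (- f) (- f')"
  using two_sided_ideal_uminus[of "f - f'"]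
  by (simp add: weyl_rel_def weyl_ideal_def algebra_simps)

lemma weyl_rel_diff: "weyl_rel f f' \<Longrightarrow> weyl_rel g g' \<Longrightarrow> weyl_rel (f - g) (f' - g')"
  using weyl_rel_add[OF _ weyl_rel_uminus, of f f' g g'] by simp

lemma weyl_rel_mult:
  assumes "weyl_rel f f'" and "weyl_rel g g'"
  shows "weyl_rel (f * g) (f' * g')"
proof -
  have "f * g - f' * g' = (f - f') * g + f' * (g - g')"
    by (simp add: algebra_simps)
  with assms show ?thesis
    by (auto simp: weyl_rel_def weyl_ideal_def
        intro: two_sided_ideal.add two_sided_ideal.mult_left two_sided_ideal.mult_right)
qed

lemma weyl_rel_scale: "weyl_rel f f' \<Longrightarrow> weyl_rel (free_scale c f) (free_scale c f')"
  unfolding free_scale_eq_mult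
  by (rule weyl_rel_mult) (simp_all add: weyl_rel_def weyl_ideal_def two_sided_ideal.zero)

lemma equivp_weyl_rel: "equivp weyl_rel"
proof (rule equivpI)
  show "reflp weyl_rel"
    by (simp add: reflp_def weyl_rel_def weyl_ideal_def two_sided_ideal.zero)
  show "symp weyl_rel"
    using two_sided_ideal_uminus
    by (fastforce simp: symp_def weyl_rel_def weyl_ideal_def)
  show "transp weyl_rel"
    using two_sided_ideal.add
    by (fastforce simp: transp_def weyl_rel_def weyl_ideal_def)
qed

text \<open>
  The type class \<^class>\<open>ring_1\<close> requires \<open>0 \<noteq> 1\<close>. The ideal is proper because it annihilates
  the polynomials on which \<open>x\<close> acts by multiplication and \<open>y\<close> by differentiation.
\<close>

primrec gen_act :: "weyl_generator \<Rightarrow> 'f::field poly \<Rightarrow> 'f poly" where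
  "gen_act GenX p = pCons 0 p"
| "gen_act GenY p = pderiv p"

definition weyl_act :: "(weyl_generator, 'f::field) free_algebra \<Rightarrow> 'f poly \<Rightarrow> 'f poly"
  where "weyl_act f p =
    (\<Sum>w\<in>Poly_Mapping.keys f. smult (Poly_Mapping.lookup f w) (foldr gen_act (letters w) p))"

lemma foldr_gen_act_add:
  "foldr gen_act ws (p + q) = foldr gen_act ws p + foldr gen_act ws q"
proof (induction ws)
  case (Cons g ws)
  then show ?case by (cases g) (simp_all add: pderiv_add)
qed simp

lemma foldr_gen_act_smult: "foldr gen_act ws (smult c p) = smult c (foldr gen_act ws p)"
proof (induction ws)
  case (Cons g ws)
  then show ?case by (cases g) (simp_all add: pderiv_smult)
qed simp

lemma weyl_act_superset:
  "finite A \<Longrightarrow> Poly_Mapping.keys f \<subseteq> A \<Longrightarrow>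
    weyl_act f p = (\<Sum>w\<in>A. smult (Poly_Mapping.lookup f w) (foldr gen_act (letters w) p))"
  unfolding weyl_act_def by (rule sum.mono_neutral_left) (auto simp: in_keys_iff)

lemma weyl_act_add: "weyl_act (f + g) p = weyl_act f p + weyl_act g p"
proof -
  let ?A = "Poly_Mapping.keys f \<union> Poly_Mapping.keys g"
  have "Poly_Mapping.keys (f + g) \<subseteq> ?A"
    by (rule keys_add)
  then show ?thesis
    using weyl_act_superset[of ?A "f + g" p] weyl_act_superset[of ?A f p]
      weyl_act_superset[of ?A g p]
    by (simp add: lookup_add smult_add_left sum.distrib)
qed

lemma weyl_act_single:
  "weyl_act (Poly_Mapping.single w c) p = smult c (foldr gen_act (letters w) p)"
  using weyl_act_superset[of "{w}" "Poly_Mapping.single w c" p] by simp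

lemma weyl_act_zero: "weyl_act 0 p = 0"
  by (simp add: weyl_act_def)

lemma weyl_act_uminus: "weyl_act (- f) p = - weyl_act f p"
  using weyl_act_add[of f "- f" p] by (simp add: weyl_act_zero eq_neg_iff_add_eq_0 add.commute)

lemma weyl_act_diff: "weyl_act (f - g) p = weyl_act f p - weyl_act g p"
  using weyl_act_add[of f "- g" p] by (simp add: weyl_act_uminus)

lemma weyl_act_zero_right: "weyl_act f 0 = 0"
proof -
  have "foldr gen_act ws 0 = (0 :: 'a poly)" for ws
    using foldr_gen_act_smult[of ws 0 0] by simp
  then show ?thesis by (simp add: weyl_act_def)
qed

lemma weyl_act_add_right: "weyl_act f (p + q) = weyl_act f p + weyl_act f q"
  by (simp add: weyl_act_def foldr_gen_act_add smult_add_right sum.distrib)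

lemma weyl_act_mult: "weyl_act (f * g) p = weyl_act f (weyl_act g p)"
proof (induction f rule: free_algebra_induct)
  case (single w c)
  show ?case
  proof (induction g rule: free_algebra_induct)
    case (single v d)
    then show ?case
      by (simp add: mult_single weyl_act_single plus_word_def foldr_gen_act_smult)
  next
    case (sum g h)
    then show ?case by (simp add: distrib_left weyl_act_add weyl_act_add_right)
  qed
next
  case (sum f h)
  then show ?case by (simp add: distrib_right weyl_act_add)
qed

lemma weyl_act_one: "weyl_act 1 p = p"
  using weyl_act_single[of 0 1 p] by (simp add: zero_word_def flip: single_one)

lemma weyl_act_ideal: "f \<in> weyl_ideal \<Longrightarrow> weyl_act f p = 0"
  unfolding weyl_ideal_def
proof (induction arbitrary: p rule: two_sided_ideal.induct)
  case (generator s)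
  then show ?case
    by (simp add: weyl_act_diff weyl_act_add weyl_act_mult weyl_act_one letter_def
        weyl_act_single pderiv_pCons)
qed (simp_all add: weyl_act_zero weyl_act_add weyl_act_mult weyl_act_zero_right)

lemma one_notin_weyl_ideal: "1 \<notin> weyl_ideal"
  using weyl_act_ideal[of 1 1] by (auto simp: weyl_act_one)

quotient_type (overloaded) 'f weyl = "(weyl_generator, 'f::field) free_algebra" / weyl_rel
  by (rule equivp_weyl_rel)

instantiation weyl :: (field) ring_1
begin

lift_definition zero_weyl :: "'a weyl" is 0 .
lift_definition one_weyl :: "'a weyl" is 1 .
lift_definition plus_weyl :: "'a weyl \<Rightarrow> 'a weyl \<Rightarrow> 'a weyl" is "(+)"
  by (rule weyl_rel_add)
lift_definition uminus_weyl :: "'a weyl \<Rightarrow> 'a weyl" is uminus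
  by (rule weyl_rel_uminus)
lift_definition times_weyl :: "'a weyl \<Rightarrow> 'a weyl \<Rightarrow> 'a weyl" is "(*)"
  by (rule weyl_rel_mult)

lift_definition minus_weyl :: "'a weyl \<Rightarrow> 'a weyl \<Rightarrow> 'a weyl" is "(-)"
  by (rule weyl_rel_diff)

instance
proof
  fix a b c :: "'a weyl"
  have eq: "f = g \<Longrightarrow> weyl_rel f g" for f g :: "(weyl_generator, 'a) free_algebra"
    using equivp_reflp[OF equivp_weyl_rel] by auto
  show "a + b + c = a + (b + c)" by transfer (simp add: eq add.assoc)
  show "a + b = b + a" by transfer (simp add: eq add.commute)
  show "0 + a = a" by transfer (simp add: eq)
  show "- a + a = 0" by transfer (simp add: eq)
  show "a - b = a + - b" by transfer (simp add: eq)
  show "a * b * c = a * (b * c)" by transfer (simp add: eq mult.assoc)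
  show "1 * a = a" by transfer (simp add: eq)
  show "a * 1 = a" by transfer (simp add: eq)
  show "(a + b) * c = a * c + b * c" by transfer (simp add: eq distrib_right)
  show "a * (b + c) = a * b + a * c" by transfer (simp add: eq distrib_left)
  show "(0 :: 'a weyl) \<noteq> 1"
    by transfer (use one_notin_weyl_ideal two_sided_ideal_uminus in
        \<open>fastforce simp: weyl_rel_def weyl_ideal_def\<close>)
qed

end

lift_definition weyl_scale :: "'f::field \<Rightarrow> 'f weyl \<Rightarrow> 'f weyl" is free_scale
  by (rule weyl_rel_scale)

global_interpretation weyl: assoc_algebra "weyl_scale :: 'f::field \<Rightarrow> 'f weyl \<Rightarrow> 'f weyl"
proof
  fix c d :: 'f and a b :: "'f weyl"
  have eq: "f = g \<Longrightarrow> weyl_rel f g" for f g :: "(weyl_generator, 'f) free_algebra"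
    using equivp_reflp[OF equivp_weyl_rel] by auto
  show "weyl_scale c (a + b) = weyl_scale c a + weyl_scale c b"
    by transfer (simp add: eq free.scale_right_distrib)
  show "weyl_scale (c + d) a = weyl_scale c a + weyl_scale d a"
    by transfer (simp add: eq free.scale_left_distrib)
  show "weyl_scale c (weyl_scale d a) = weyl_scale (c * d) a"
    by transfer (simp add: eq)
  show "weyl_scale 1 a = a"
    by transfer (simp add: eq)
  show "weyl_scale c a * b = weyl_scale c (a * b)"
    by transfer (simp add: eq free.scale_mult_left)
  show "a * weyl_scale c b = weyl_scale c (a * b)"
    by transfer (simp add: eq free.scale_mult_right)
qed

lift_definition weyl_x :: "'f::field weyl" is "letter GenX" .
lift_definition weyl_y :: "'f::field weyl" is "letter GenY" .

lemma weyl_relation: "weyl_y * weyl_x = weyl_x * weyl_y + 1"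
  by transfer (simp add: weyl_rel_def weyl_ideal_def two_sided_ideal.generator)

definition weyl_of_poly :: "'f::field poly \<Rightarrow> 'f weyl"
  where "weyl_of_poly p = (\<Sum>i\<le>degree p. weyl_scale (coeff p i) (weyl_x ^ i))"

definition weyl_minus_1 :: "'f::field weyl set"
  where "weyl_minus_1 = weyl.span (range (\<lambda>p. weyl_of_poly p * weyl_y))"


section \<open>The multilinear polynomials in four variables\<close>

text \<open>
  The letters of \<open>F\<langle>X\<rangle>\<close> are indexed by \<^typ>\<open>nat\<close>, starting from \<open>0\<close>, whereas the variables are
  numbered from \<open>1\<close>. So \<open>var i\<close> is only meaningful for \<open>i \<ge> 1\<close>.
\<close>

definition var :: "nat \<Rightarrow> (nat, 'f::field) free_algebra"
  where "var i = letter (i - 1)"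

abbreviation x1 :: "(nat, 'f::field) free_algebra" where "x1 \<equiv> var 1"
abbreviation x2 :: "(nat, 'f::field) free_algebra" where "x2 \<equiv> var 2"
abbreviation x3 :: "(nat, 'f::field) free_algebra" where "x3 \<equiv> var 3"
abbreviation x4 :: "(nat, 'f::field) free_algebra" where "x4 \<equiv> var 4"

definition multidegree_1111 :: "(nat, 'f::field) free_algebra set"
  where "multidegree_1111 =
    free.span {var (\<sigma> 1) * var (\<sigma> 2) * var (\<sigma> 3) * var (\<sigma> 4) | \<sigma>. \<sigma> permutes {1..4}}"

definition commutator :: "'a::ring_1 \<Rightarrow> 'a \<Rightarrow> 'a"
  where "commutator a b = a * b - b * a"

definition St3 :: "'a::ring_1 \<Rightarrow> 'a \<Rightarrow> 'a \<Rightarrow> 'a"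
  where "St3 z1 z2 z3 =
    (let z = (\<lambda>i::nat. if i = 1 then z1 else if i = 2 then z2 else z3)
     in \<Sum>\<sigma> | \<sigma> permutes {1..3}. of_int (sign \<sigma>) * z (\<sigma> 1) * z (\<sigma> 2) * z (\<sigma> 3))"

definition Gamma_poly :: "(nat, 'f::field) free_algebra"
  where "Gamma_poly =
    - x1 * x2 * x3 * x4 + 2 * x1 * x2 * x4 * x3 + x1 * x3 * x4 * x2 - 2 * x1 * x4 * x2 * x3
    + 2 * x2 * x1 * x3 * x4 - 2 * x2 * x1 * x4 * x3 - 2 * x2 * x3 * x1 * x4
    + x2 * x3 * x4 * x1 + x2 * x4 * x1 * x3
    + x3 * x1 * x2 * x4 - 2 * x3 * x1 * x4 * x2 + x3 * x4 * x1 * x2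
    + x4 * x1 * x2 * x3 - x4 * x2 * x3 * x1"

definition Psi_poly :: "(nat, 'f::field) free_algebra"
  where "Psi_poly = x2 * commutator x1 x4 * x3 + x3 * commutator x1 x4 * x2"

definition Delta_poly :: "(nat, 'f::field) free_algebra"
  where "Delta_poly =
    x2 * x1 * x3 * x4 + x2 * x4 * x1 * x3 + x3 * x1 * x2 * x4
    + x3 * x4 * x1 * x2 + x4 * x1 * x2 * x3 + x4 * x1 * x3 * x2"

definition Lambda_poly :: "(nat, 'f::field) free_algebra"
  where "Lambda_poly =
    - 3 * x1 * x2 * x3 * x4 + 3 * x1 * x2 * x4 * x3 + 2 * x1 * x3 * x2 * x4
    - 2 * x1 * x4 * x2 * x3
    + 3 * x2 * x1 * x3 * x4 - 3 * x2 * x1 * x4 * x3 - 2 * x2 * x3 * x1 * x4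
    + 2 * x2 * x4 * x1 * x3
    - x3 * x1 * x4 * x2 + x3 * x2 * x4 * x1 + x4 * x1 * x3 * x2 - x4 * x2 * x3 * x1"

end

theory Submission
  imports Defs "HOL-Combinatorics.Multiset_Permutations"
begin

text \<open>
  In characteristic 2 every second derivative of a polynomial vanishes, so for \<open>a, b, c, d\<close> in
  \<open>F[x]\<close> the product \<open>(a y) (b y) (c y) (d y)\<close> has the normal form
  \<open>a b c d y\<^sup>4 + a (b' c d + b c d') y\<^sup>3 + a b' c' d y\<^sup>2 + a b' c' d' y\<close>.
  Taking each variable to be \<open>1\<close> or \<open>x\<close> and comparing constant terms, one obtains linear
  conditions on the 24 coefficients of a multilinear identity. Together with twelve functionals
  dual to the claimed basis they have only the trivial solution, so the basis spans. Conversely,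
  substituting these normal forms into each basis element gives zero.
\<close>

section \<open>Evaluation and bases\<close>

context assoc_algebra
begin

lemma eval_superset:
  "finite A \<Longrightarrow> Poly_Mapping.keys f \<subseteq> A \<Longrightarrow>
    eval a f = (\<Sum>w\<in>A. scale (Poly_Mapping.lookup f w) (prod_list (map a (letters w))))"
  unfolding eval_def by (rule sum.mono_neutral_left) (auto simp: in_keys_iff)

lemma eval_add: "eval a (f + g) = eval a f + eval a g"
proof -
  let ?A = "Poly_Mapping.keys f \<union> Poly_Mapping.keys g"
  have "Poly_Mapping.keys (f + g) \<subseteq> ?A"
    by (rule keys_add)
  then show ?thesis
    using eval_superset[of ?A "f + g" a] eval_superset[of ?A f a] eval_superset[of ?A g a]
    by (simp add: lookup_add scale_left_distrib sum.distrib)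
qed

lemma eval_zero: "eval a 0 = 0"
  by (simp add: eval_def)

lemma eval_single:
  "eval a (Poly_Mapping.single w c) = scale c (prod_list (map a (letters w)))"
  using eval_superset[of "{w}" "Poly_Mapping.single w c" a] by simp

lemma eval_free_scale: "eval a (free_scale c f) = scale c (eval a f)"
proof (induction f rule: free_algebra_induct)
  case (single w d)
  then show ?case by (simp add: free_scale_single eval_single)
next
  case (sum f g)
  then show ?case by (simp add: free.scale_right_distrib eval_add scale_right_distrib)
qed

lemma subspace_polynomial_identity: "free.subspace {f. polynomial_identity V f}"
  by (rule free.subspaceI)
    (simp_all add: polynomial_identity_def eval_zero eval_add eval_free_scale)

text \<open>Duality gives distinctness and independence, the \<open>L j\<close> being coordinates.
  For \<open>u\<close> in \<open>U\<close>, the difference between \<open>u\<close> and its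
  expansion with coordinates \<open>L j u\<close> is killed by every \<open>L j\<close>, hence is
  zero by \<open>inj\<close>; this replaces a dimension count.\<close>

lemma is_basis_of_dual:
  fixes L :: "nat \<Rightarrow> 'a \<Rightarrow> 'f"
  assumes U: "subspace U" "set bs \<subseteq> U"
    and L_add: "\<And>j a b. L j (a + b) = L j a + L j b"
    and L_scale: "\<And>j c a. L j (scale c a) = c * L j a"
    and dual: "\<And>i j. i < length bs \<Longrightarrow> j < length bs \<Longrightarrow> L j (bs ! i) = of_bool (i = j)"
    and inj: "\<And>u. u \<in> U \<Longrightarrow> (\<And>j. j < length bs \<Longrightarrow> L j u = 0) \<Longrightarrow> u = 0"
  shows "is_basis_of bs U"
proof -
  have L_zero: "L j 0 = 0" for j
    using L_scale[of j 0 0] by simp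
  have L_sum: "L j (\<Sum>i\<in>A. f i) = (\<Sum>i\<in>A. L j (f i))" for j f and A :: "nat set"
    by (induction A rule: infinite_finite_induct) (simp_all add: L_zero L_add)
  have dist: "distinct bs"
    unfolding distinct_conv_nth
  proof (intro allI impI notI)
    fix i j
    assume "i < length bs" "j < length bs" "i \<noteq> j" "bs ! i = bs ! j"
    then show False
      using dual[of i j] dual[of j j] by simp
  qed
  have set_bs: "set bs = (!) bs ` {..<length bs}"
    by (auto simp: set_conv_nth)
  have inj_nth: "inj_on ((!) bs) {..<length bs}"
    using dist by (simp add: inj_on_nth)
  have L_comb: "L j (\<Sum>i<length bs. scale (c i) (bs ! i)) = c j" if "j < length bs" for j c
    using that by (simp add: L_sum L_scale dual of_bool_def if_distrib cong: if_cong)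
  have "independent (set bs)"
    unfolding set_bs
  proof (rule independent_if_scalars_zero)
    fix f x
    assume "(\<Sum>x\<in>(!) bs ` {..<length bs}. scale (f x) x) = 0" and x: "x \<in> (!) bs ` {..<length bs}"
    then have "(\<Sum>i<length bs. scale (f (bs ! i)) (bs ! i)) = 0"
      by (simp add: sum.reindex[OF inj_nth])
    moreover obtain j where "j < length bs" "x = bs ! j"
      using x by auto
    ultimately show "f x = 0"
      using L_comb[of j "\<lambda>i. f (bs ! i)"] by (simp add: L_zero)
  qed simp
  moreover have "span (set bs) = U"
  proof
    show "span (set bs) \<subseteq> U"
      using U by (intro span_minimal)
    show "U \<subseteq> span (set bs)"
    proof
      fix u
      assume u: "u \<in> U"
      define v where "v = (\<Sum>i<length bs. scale (L i u) (bs ! i))"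
      have v: "v \<in> span (set bs)"
        unfolding v_def by (intro span_sum span_scale) (simp add: span_base)
      then have vU: "v \<in> U"
        using U span_minimal by blast
      have "L j (u - v) = 0" if "j < length bs" for j
        using L_add[of j "u - v" v] L_comb[OF that, of "\<lambda>i. L i u"] by (simp add: v_def)
      then have "u - v = 0"
        using u vU U(1) by (intro inj subspace_diff)
      with v show "u \<in> span (set bs)"
        by simp
    qed
  qed
  ultimately show ?thesis
    using dist by (simp add: is_basis_of_def)
qed

end


section \<open>Actions of a free algebra\<close>

text \<open>Any choice of linear operators for the letters extends to the free algebra. The module
  is left open so that it can be taken large enough for a faithful action of the Weyl
  algebra.\<close>

locale free_algebra_action = vector_space scale
  for scale :: "'f::field \<Rightarrow> 'm::ab_group_add \<Rightarrow> 'm" +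
  fixes gen :: "'v \<Rightarrow> 'm \<Rightarrow> 'm"
  assumes gen_add: "gen v (p + q) = gen v p + gen v q"
    and gen_scale: "gen v (scale c p) = scale c (gen v p)"
begin

definition act :: "('v, 'f) free_algebra \<Rightarrow> 'm \<Rightarrow> 'm"
  where "act f p =
    (\<Sum>w\<in>Poly_Mapping.keys f. scale (Poly_Mapping.lookup f w) (foldr gen (letters w) p))"

lemma foldr_gen_add: "foldr gen ws (p + q) = foldr gen ws p + foldr gen ws q"
  by (induction ws) (simp_all add: gen_add)

lemma foldr_gen_scale: "foldr gen ws (scale c p) = scale c (foldr gen ws p)"
  by (induction ws) (simp_all add: gen_scale)

lemma act_superset:
  "finite A \<Longrightarrow> Poly_Mapping.keys f \<subseteq> A \<Longrightarrow>
    act f p = (\<Sum>w\<in>A. scale (Poly_Mapping.lookup f w) (foldr gen (letters w) p))"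
  unfolding act_def by (rule sum.mono_neutral_left) (auto simp: in_keys_iff)

lemma act_add: "act (f + g) p = act f p + act g p"
proof -
  let ?A = "Poly_Mapping.keys f \<union> Poly_Mapping.keys g"
  have "Poly_Mapping.keys (f + g) \<subseteq> ?A"
    by (rule keys_add)
  then show ?thesis
    using act_superset[of ?A "f + g" p] act_superset[of ?A f p] act_superset[of ?A g p]
    by (simp add: lookup_add scale_left_distrib sum.distrib)
qed

lemma act_single: "act (Poly_Mapping.single w c) p = scale c (foldr gen (letters w) p)"
  using act_superset[of "{w}" "Poly_Mapping.single w c" p] by simp

lemma act_letter: "act (letter v) p = gen v p"
  by (simp add: letter_def act_single)

lemma act_zero: "act 0 p = 0"
  by (simp add: act_def)

lemma act_diff: "act (f - g) p = act f p - act g p"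
  using act_add[of "f - g" g p] by simp

lemma act_zero_right: "act f 0 = 0"
  using foldr_gen_scale[of _ 0 0] by (simp add: act_def)

lemma act_add_right: "act f (p + q) = act f p + act f q"
  by (simp add: act_def foldr_gen_add scale_right_distrib sum.distrib)

lemma act_mult: "act (f * g) p = act f (act g p)"
proof (induction f rule: free_algebra_induct)
  case (single w c)
  show ?case
  proof (induction g rule: free_algebra_induct)
    case (single v d)
    then show ?case
      by (simp add: mult_single act_single plus_word_def foldr_gen_scale)
  next
    case (sum g h)
    then show ?case by (simp add: distrib_left act_add act_add_right)
  qed
next
  case (sum f h)
  then show ?case by (simp add: distrib_right act_add)
qed

lemma act_one: "act 1 p = p"
  using act_single[of 0 1 p] by (simp add: zero_word_def flip: single_one)

lemma act_free_scale: "act (free_scale c f) p = scale c (act f p)"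
proof (induction f rule: free_algebra_induct)
  case (single w d)
  then show ?case by (simp add: free_scale_single act_single)
next
  case (sum f g)
  then show ?case by (simp add: free.scale_right_distrib act_add scale_right_distrib)
qed

end


section \<open>Normal forms in the Weyl algebra\<close>

text \<open>
  In positive characteristic the action on polynomials by multiplication and differentiation is
  not faithful. Adding to the derivation the multiplication by a new indeterminate, the
  outer one in \<^typ>\<open>'f poly poly\<close>, makes it faithful.
\<close>

primrec weyl_gen :: "weyl_generator \<Rightarrow> 'f::field poly poly \<Rightarrow> 'f poly poly" where
  "weyl_gen GenX p = smult [:0, 1:] p"
| "weyl_gen GenY p = map_poly pderiv p + pCons 0 p"

text \<open>The field acts through the constants of the coefficient ring \<open>'f poly\<close>,
  hence \<open>smult [:c:]\<close>.\<close>

global_interpretation normal: free_algebra_action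
  "\<lambda>c :: 'f::field. smult [:c:] :: 'f poly poly \<Rightarrow> _" weyl_gen
  defines normal_act = normal.act
proof
  fix c d :: 'f and p q :: "'f poly poly" and v
  show "smult [:c:] (p + q) = smult [:c:] p + smult [:c:] q"
    by (simp add: smult_add_right)
  show "smult [:c + d:] p = smult [:c:] p + smult [:d:] p"
    by (simp flip: smult_add_left)
  show "smult [:c:] (smult [:d:] p) = smult [:c * d:] p"
    by (simp add: mult.commute)
  show "smult [:1:] p = p"
    by (simp flip: one_pCons)
  show "weyl_gen v (p + q) = weyl_gen v p + weyl_gen v q"
    by (cases v; intro poly_eqI)
      (simp_all add: coeff_map_poly pderiv_add algebra_simps coeff_pCons split: nat.split)
  show "weyl_gen v (smult [:c:] p) = smult [:c:] (weyl_gen v p)"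
    by (cases v; intro poly_eqI)
      (simp_all add: coeff_map_poly pderiv_smult algebra_simps coeff_pCons split: nat.split)
qed

text \<open>The added indeterminate commutes with multiplication by x, so the modified derivation
  still has commutator 1 with it. The other cases are closure under the ideal operations.\<close>

lemma normal_act_ideal: "f \<in> weyl_ideal \<Longrightarrow> normal_act f p = 0"
  unfolding weyl_ideal_def
proof (induction arbitrary: p rule: two_sided_ideal.induct)
  case (generator s)
  have "weyl_gen GenY (weyl_gen GenX p) = weyl_gen GenX (weyl_gen GenY p) + p"
    by (intro poly_eqI)
      (simp add: coeff_map_poly pderiv_mult pderiv_pCons coeff_pCons algebra_simps split: nat.split)
  with generator show ?case
    by (simp add: normal.act_diff normal.act_add normal.act_mult normal.act_one
        normal.act_letter del: weyl_gen.simps)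
qed (simp_all add: normal.act_zero normal.act_add normal.act_mult normal.act_zero_right)

section \<open>The induced action of the Weyl algebra\<close>

lift_definition weyl_normal_act :: "'f::field weyl \<Rightarrow> 'f poly poly \<Rightarrow> 'f poly poly"
  is normal_act
proof
  fix f g :: "(weyl_generator, 'f) free_algebra" and p
  assume "weyl_rel f g"
  then have "normal_act (f - g) p = 0"
    by (simp add: weyl_rel_def normal_act_ideal)
  then show "normal_act f p = normal_act g p"
    by (simp add: normal.act_diff)
qed

lemma weyl_normal_act_zero: "weyl_normal_act 0 p = 0"
  by transfer (rule normal.act_zero)

lemma weyl_normal_act_one: "weyl_normal_act 1 p = p"
  by transfer (rule normal.act_one)

lemma weyl_normal_act_add:
  "weyl_normal_act (a + b) p = weyl_normal_act a p + weyl_normal_act b p"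
  by transfer (rule normal.act_add)

lemma weyl_normal_act_mult:
  "weyl_normal_act (a * b) p = weyl_normal_act a (weyl_normal_act b p)"
  by transfer (rule normal.act_mult)

lemma weyl_normal_act_scale:
  "weyl_normal_act (weyl_scale c a) p = smult [:c:] (weyl_normal_act a p)"
  by transfer (rule normal.act_free_scale)

lemma weyl_normal_act_x: "weyl_normal_act weyl_x p = smult [:0, 1:] p"
  by transfer (simp add: normal.act_letter)

lemma weyl_normal_act_y: "weyl_normal_act weyl_y p = map_poly pderiv p + pCons 0 p"
  by transfer (simp add: normal.act_letter)

section \<open>The subalgebra F[x] and the elements p y\<close>

lemma weyl_of_poly_superset:
  assumes "degree p \<le> n"
  shows "weyl_of_poly p = (\<Sum>i\<le>n. weyl_scale (coeff p i) (weyl_x ^ i))"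
  unfolding weyl_of_poly_def using assms
  by (intro sum.mono_neutral_left) (auto simp: coeff_eq_0)

lemma weyl_of_poly_zero [simp]: "weyl_of_poly 0 = 0"
  by (simp add: weyl_of_poly_def)

lemma weyl_of_poly_add: "weyl_of_poly (p + q) = weyl_of_poly p + weyl_of_poly q"
  by (simp add: weyl_of_poly_superset[of _ "max (degree p) (degree q)"] degree_add_le_max
      weyl.scale_left_distrib sum.distrib)

lemma weyl_of_poly_smult: "weyl_of_poly (smult c p) = weyl_scale c (weyl_of_poly p)"
  by (simp add: weyl_of_poly_superset[of _ "degree p"] degree_smult_le weyl.scale_sum_right)

lemma weyl_of_poly_pCons:
  "weyl_of_poly (pCons c p) = weyl_scale c 1 + weyl_x * weyl_of_poly p"
  by (simp add: weyl_of_poly_superset[of "pCons c p" "Suc (degree p)"] degree_pCons_le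
      weyl_of_poly_superset[of p "degree p"] sum.atMost_Suc_shift sum_distrib_left
      weyl.scale_mult_right del: sum.atMost_Suc)

lemma weyl_of_poly_mult: "weyl_of_poly (p * q) = weyl_of_poly p * weyl_of_poly q"
proof (induction p)
  case (pCons c p)
  then show ?case
    by (simp add: weyl_of_poly_add weyl_of_poly_smult weyl_of_poly_pCons algebra_simps
        weyl.scale_mult_left)
qed simp

text \<open>Commutation with \<open>weyl_y\<close> is a derivation that sends \<open>weyl_x\<close>
  to 1, so on F[x] it is differentiation; the induction moves \<open>weyl_y\<close> past one factor
  \<open>weyl_x\<close> at a time.\<close>

lemma weyl_y_times_weyl_of_poly:
  "weyl_y * weyl_of_poly p = weyl_of_poly p * weyl_y + weyl_of_poly (pderiv p)"
proof (induction p)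
  case (pCons c p)
  have "weyl_y * (weyl_x * weyl_of_poly p) =
      (weyl_x * weyl_y + 1) * weyl_of_poly p"
    by (simp add: weyl_relation flip: mult.assoc)
  also have "\<dots> = weyl_x * (weyl_y * weyl_of_poly p) + weyl_of_poly p"
    by (simp add: algebra_simps)
  finally show ?case
    by (simp add: pCons weyl_of_poly_pCons pderiv_pCons weyl_of_poly_add algebra_simps
        weyl.scale_mult_left weyl.scale_mult_right)
qed simp

lemma weyl_normal_act_weyl_of_poly: "weyl_normal_act (weyl_of_poly p) q = smult p q"
proof (induction p arbitrary: q)
  case (pCons c p)
  have "smult (pCons c p) q = smult ([:c:] + [:0, 1:] * p) q"
    by simp
  also have "\<dots> = smult [:c:] q + smult [:0, 1:] (smult p q)"
    by (simp only: smult_add_left smult_smult)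
  finally show ?case
    by (simp only: pCons weyl_of_poly_pCons weyl_normal_act_add weyl_normal_act_mult
        weyl_normal_act_scale weyl_normal_act_one weyl_normal_act_x)
qed (simp add: weyl_normal_act_zero)

text \<open>The elements p y are already closed under sums and scalars, so the span adds nothing.
  Each variable can thus be replaced by a single polynomial times \<open>weyl_y\<close>.\<close>

lemma weyl_minus_1_eq: "weyl_minus_1 = range (\<lambda>p. weyl_of_poly p * weyl_y)"
proof -
  have "weyl.subspace (range (\<lambda>p. weyl_of_poly p * weyl_y :: 'a weyl))"
  proof (rule weyl.subspaceI)
    show "0 \<in> range (\<lambda>p. weyl_of_poly p * weyl_y :: 'a weyl)"
      by (intro image_eqI[of _ _ 0]) simp_all
  next
    fix a b :: "'a weyl"
    assume "a \<in> range (\<lambda>p. weyl_of_poly p * weyl_y)" "b \<in> range (\<lambda>p. weyl_of_poly p * weyl_y)"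
    then obtain p q where "a = weyl_of_poly p * weyl_y" "b = weyl_of_poly q * weyl_y"
      by auto
    then show "a + b \<in> range (\<lambda>p. weyl_of_poly p * weyl_y)"
      by (intro image_eqI[of _ _ "p + q"]) (simp_all add: weyl_of_poly_add distrib_right)
  next
    fix c and a :: "'a weyl"
    assume "a \<in> range (\<lambda>p. weyl_of_poly p * weyl_y)"
    then obtain p where "a = weyl_of_poly p * weyl_y"
      by auto
    then show "weyl_scale c a \<in> range (\<lambda>p. weyl_of_poly p * weyl_y)"
      by (intro image_eqI[of _ _ "smult c p"])
        (simp_all add: weyl_of_poly_smult weyl.scale_mult_left)
  qed
  then show ?thesis
    by (simp add: weyl_minus_1_def)
qed

section \<open>Normal forms with powers of y from 1 to 4\<close>

text \<open>Powers of \<open>weyl_y\<close> stand to the right of their coefficients. Exponents 1 to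
  4 cover all products of at most four elements p y.\<close>

definition weyl4 :: "'f::field poly \<Rightarrow> 'f poly \<Rightarrow> 'f poly \<Rightarrow> 'f poly \<Rightarrow> 'f weyl"
  where "weyl4 p4 p3 p2 p1 =
    weyl_of_poly p4 * weyl_y ^ 4 + weyl_of_poly p3 * weyl_y ^ 3
      + weyl_of_poly p2 * weyl_y ^ 2 + weyl_of_poly p1 * weyl_y"

lemma weyl4_zero: "weyl4 0 0 0 0 = 0"
  by (simp add: weyl4_def)

lemma weyl4_add:
  "weyl4 p4 p3 p2 p1 + weyl4 q4 q3 q2 q1 = weyl4 (p4 + q4) (p3 + q3) (p2 + q2) (p1 + q1)"
  by (simp add: weyl4_def weyl_of_poly_add algebra_simps)

lemma weyl_scale_weyl4:
  "weyl_scale c (weyl4 p4 p3 p2 p1) = weyl4 (smult c p4) (smult c p3) (smult c p2) (smult c p1)"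
  by (simp add: weyl4_def weyl_of_poly_smult weyl.scale_right_distrib weyl.scale_mult_left)

lemma sum_weyl4:
  "(\<Sum>i\<in>A. weyl4 (p4 i) (p3 i) (p2 i) (p1 i)) =
    weyl4 (\<Sum>i\<in>A. p4 i) (\<Sum>i\<in>A. p3 i) (\<Sum>i\<in>A. p2 i) (\<Sum>i\<in>A. p1 i)"
  by (induction A rule: infinite_finite_induct) (simp_all add: weyl4_zero weyl4_add)

text \<open>The powers of y are independent over F[x]: in the faithful action y^n sends 1 to the
  n-th power of the outer indeterminate, since constant coefficients have derivative zero. The four
  polynomials then appear as coefficients.\<close>

lemma weyl4_eq_0_iff: "weyl4 p4 p3 p2 p1 = 0 \<longleftrightarrow> p4 = 0 \<and> p3 = 0 \<and> p2 = 0 \<and> p1 = 0"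
proof
  assume "weyl4 p4 p3 p2 p1 = 0"
  then have "weyl_normal_act (weyl4 p4 p3 p2 p1) 1 = 0"
    by (simp add: weyl_normal_act_zero)
  moreover have "weyl_normal_act (weyl4 p4 p3 p2 p1) 1 = [:0, p1, p2, p3, p4:]"
    by (simp add: weyl4_def weyl_normal_act_add weyl_normal_act_mult eval_nat_numeral
        weyl_normal_act_weyl_of_poly weyl_normal_act_y map_poly_pCons one_pCons)
  ultimately show "p4 = 0 \<and> p3 = 0 \<and> p2 = 0 \<and> p1 = 0"
    by simp
qed (simp add: weyl4_zero)


section \<open>Characteristic two\<close>

lemma two_eq_zero:
  assumes "CHAR('a::semiring_1) = 2"
  shows "(2::'a) = 0"
  using of_nat_CHAR[where 'a = 'a] by (simp add: assms)

text \<open>Together these rules normalise sums in characteristic 2: the second cancels equal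
  neighbours inside a sorted sum, the last two reduce numerals by parity.\<close>

lemma char2_ring:
  fixes a b :: "'a::ring_1"
  assumes "(2::'a) = 0"
  shows "a + a = 0" and "a + (a + b) = b" and "- a = a" and "a - b = a + b"
    and "numeral (num.Bit0 k) = (0 :: 'a)" and "numeral (num.Bit1 k) = (1 :: 'a)"
proof -
  show *: "a + a = 0" for a :: 'a
    using assms by (simp flip: mult_2)
  show uminus: "- a = a" for a :: 'a
    using *[of a] by (simp add: minus_unique)
  show "a + (a + b) = b"
    by (simp add: * flip: add.assoc)
  show "a - b = a + b"
    using uminus[of b] by (simp add: diff_conv_add_uminus del: add_uminus_conv_diff)
  show "numeral (num.Bit0 k) = (0 :: 'a)"
    using * by (simp only: numeral_Bit0)
  show "numeral (num.Bit1 k) = (1 :: 'a)"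
    using * by (simp only: numeral_Bit1 add_0_left)
qed

lemma two_eq_zero_free_algebra:
  assumes "(2::'f::field) = 0"
  shows "(2 :: ('v, 'f) free_algebra) = 0"
proof -
  have "(2 :: ('v, 'f) free_algebra) = free_scale 1 1 + free_scale 1 1"
    by simp
  also have "\<dots> = free_scale (1 + 1) 1"
    by (rule free.scale_left_distrib[symmetric])
  finally show ?thesis
    by (simp add: assms)
qed

lemma two_eq_zero_poly: "(2::'f::field) = 0 \<Longrightarrow> (2 :: 'f poly) = 0"
  by (simp add: numeral_poly)

text \<open>Each coefficient of a second derivative carries a product of two consecutive integers,
  which is even.\<close>

lemma pderiv_pderiv_char2:
  fixes p :: "'f::field poly"
  assumes "(2::'f) = 0"
  shows "pderiv (pderiv p) = 0"
proof (rule poly_eqI)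
  fix n
  have "even (Suc n * Suc (Suc n))"
    by simp
  then obtain k where "Suc n * Suc (Suc n) = 2 * k"
    by (rule evenE)
  then have "of_nat (Suc n) * of_nat (Suc (Suc n)) = (of_nat (2 * k) :: 'f)"
    by (simp only: of_nat_mult[symmetric])
  also have "\<dots> = 0"
    by (simp add: assms)
  finally show "coeff (pderiv (pderiv p)) n = coeff 0 n"
    by (simp only: coeff_pderiv coeff_0 mult_zero_left mult.assoc[symmetric])
qed

text \<open>All signs become 1 because -1 = 1.\<close>

lemma St3_char2:
  fixes z1 z2 z3 :: "'a::ring_1"
  assumes "(2::'a) = 0"
  shows "St3 z1 z2 z3 =
    z1 * z2 * z3 + z1 * z3 * z2 + z2 * z1 * z3 + z2 * z3 * z1 + z3 * z1 * z2 + z3 * z2 * z1"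
proof -
  have sign: "of_int (sign \<sigma>) = (1 :: 'a)" for \<sigma> :: "nat \<Rightarrow> nat"
    using char2_ring(3)[OF assms, of 1] by (cases \<sigma> rule: sign_cases) simp_all
  have "{1..3} = {1, 2, 3 :: nat}"
    by auto
  then show ?thesis
    by (simp add: St3_def sign sum_over_permutations_insert permutes_sing transpose_def ac_simps)
qed

text \<open>By the Leibniz rule, p y q y^i = p q y^(i+1) + p q' y^i. The zero in the first slot
  keeps the exponents of the product at most 4.\<close>

lemma weyl_of_poly_y_times_weyl4:
  "weyl_of_poly p * weyl_y * weyl4 0 q3 q2 q1 =
    weyl4 (p * q3) (p * (q2 + pderiv q3)) (p * (q1 + pderiv q2)) (p * pderiv q1)"
proof -
  \<comment> \<open>The trailing factor \<open>z\<close> lets the rule apply inside products nested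
    to the right.\<close>
  have y: "weyl_y * (weyl_of_poly q * z) =
      weyl_of_poly q * (weyl_y * z) + weyl_of_poly (pderiv q) * z" for q :: "'a poly" and z
    using weyl_y_times_weyl_of_poly[of q] by (simp add: distrib_right flip: mult.assoc)
  show ?thesis
    by (simp add: weyl4_def y eval_nat_numeral weyl_of_poly_mult weyl_of_poly_add mult.assoc
        distrib_left distrib_right add.assoc)
qed

text \<open>The factors are multiplied on from right to left. Terms with a second derivative vanish,
  and mixed terms that arise twice cancel, such as a b c' d in the coefficient of y^3 for factors a
  y, b y, c y, d y.\<close>

lemma weyl_product_char2:
  fixes p :: "'v \<Rightarrow> 'f::field poly"
  assumes "(2::'f) = 0"
  shows "prod_list (map (\<lambda>v. weyl_of_poly (p v) * weyl_y) [i, j, k, m]) =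
    weyl4 (p i * p j * p k * p m)
      (p i * (pderiv (p j) * p k * p m + p j * p k * pderiv (p m)))
      (p i * pderiv (p j) * pderiv (p k) * p m)
      (p i * pderiv (p j) * pderiv (p k) * pderiv (p m))"
proof -
  have y: "weyl_of_poly (p m) * weyl_y = weyl4 0 0 0 (p m)"
    by (simp add: weyl4_def)
  show ?thesis
    by (simp add: y weyl_of_poly_y_times_weyl4 pderiv_mult pderiv_add
        pderiv_pderiv_char2[OF assms])
      (simp add: char2_ring[OF two_eq_zero_poly[OF assms]] algebra_simps)
qed


section \<open>Multilinear polynomials\<close>

text \<open>Letters start at 0, so x1 x2 x3 x4 is \<open>[0, 1, 2, 3]\<close>. An explicit list
  allows sums over the 24 words to be expanded by simplification.\<close>

definition perm_words :: "nat list list"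
  where "perm_words =
    [[0, 1, 2, 3], [0, 1, 3, 2], [0, 2, 1, 3], [0, 2, 3, 1], [0, 3, 1, 2], [0, 3, 2, 1],
     [1, 0, 2, 3], [1, 0, 3, 2], [1, 2, 0, 3], [1, 2, 3, 0], [1, 3, 0, 2], [1, 3, 2, 0],
     [2, 0, 1, 3], [2, 0, 3, 1], [2, 1, 0, 3], [2, 1, 3, 0], [2, 3, 0, 1], [2, 3, 1, 0],
     [3, 0, 1, 2], [3, 0, 2, 1], [3, 1, 0, 2], [3, 1, 2, 0], [3, 2, 0, 1], [3, 2, 1, 0]]"

lemma distinct_perm_words: "distinct perm_words"
  by (simp add: perm_words_def)

lemma permutation_0123I:
  "length l = 4 \<Longrightarrow> distinct l \<Longrightarrow> set l \<subseteq> {0..3} \<Longrightarrow> l \<in> permutations_of_set {0..3::nat}"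
  using card_subset_eq[of "{0..3}" "set l"] by (simp add: permutations_of_set_def distinct_card)

text \<open>One inclusion and equal cardinality 24 spare the enumeration of all
  permutations.\<close>

lemma permutations_of_set_0123: "permutations_of_set {0..3} = set perm_words"
proof (rule card_subset_eq[symmetric])
  show "set perm_words \<subseteq> permutations_of_set {0..3}"
    by (auto simp: perm_words_def intro!: permutation_0123I)
  have "card (set perm_words) = 24"
    by (simp add: distinct_card[OF distinct_perm_words]) (simp add: perm_words_def)
  then show "card (set perm_words) = card (permutations_of_set {0..3::nat})"
    by (simp add: fact_numeral)
qed simp

lemma sum_perm_words:
  "(\<Sum>l\<in>permutations_of_set {0..3}. g l) = (\<Sum>l\<leftarrow>perm_words. g l)"
  using distinct_perm_words by (simp add: permutations_of_set_0123 sum_list_distinct_conv_sum_set)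

text \<open>Coefficients 1 are enough to describe the basis, as only the parities of its integer
  coefficients survive modulo 2.\<close>

definition word_poly :: "'v list list \<Rightarrow> ('v, 'f::field) free_algebra"
  where "word_poly ls = (\<Sum>l\<leftarrow>ls. Poly_Mapping.single (Word l) 1)"

lemma lookup_word_poly:
  "distinct ls \<Longrightarrow> Poly_Mapping.lookup (word_poly ls) (Word l) = of_bool (l \<in> set ls)"
  by (induction ls) (auto simp: word_poly_def lookup_add lookup_single when_def)

lemma word_poly_mult: "word_poly [k] * word_poly [l] = word_poly [k @ l]"
  by (simp add: word_poly_def mult_single plus_word_def)

lemma word_poly_Cons: "word_poly (l # ls) = word_poly [l] + word_poly ls"
  by (simp add: word_poly_def)

lemma var_eq: "var i = word_poly [[i - 1]]"
  by (simp add: var_def word_poly_def letter_def)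

lemma (in assoc_algebra) eval_word_poly:
  "eval a (word_poly ls) = (\<Sum>l\<leftarrow>ls. prod_list (map a l))"
  by (induction ls) (simp_all add: word_poly_def eval_zero eval_add eval_single)

text \<open>A permutation \<sigma> of 1..4 and the list of the values \<sigma> i - 1 determine each
  other, so both spanning sets consist of the same monomials.\<close>

lemma multidegree_1111_eq:
  "(multidegree_1111 :: (nat, 'f::field) free_algebra set) =
    free.span ((\<lambda>l. word_poly [l]) ` permutations_of_set {0..3})"
proof -
  have "{var (\<sigma> 1) * var (\<sigma> 2) * var (\<sigma> 3) * var (\<sigma> 4) | \<sigma>. \<sigma> permutes {1..4}} =
      ((\<lambda>l. word_poly [l]) ` permutations_of_set {0..3} :: (nat, 'f) free_algebra set)"
      (is "?A = ?B")
  proof (intro equalityI subsetI)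
    fix f
    assume "f \<in> ?A"
    then obtain \<sigma> where f: "f = var (\<sigma> 1) * var (\<sigma> 2) * var (\<sigma> 3) * var (\<sigma> 4)"
      and \<sigma>: "\<sigma> permutes {1..4}"
      by blast
    define l where "l = [\<sigma> 1 - 1, \<sigma> 2 - 1, \<sigma> 3 - 1, \<sigma> 4 - 1]"
    have \<sigma>_range: "1 \<le> \<sigma> i" "\<sigma> i \<le> 4" if "i \<in> {1..4}" for i
      using permutes_in_image[OF \<sigma>, of i] that by auto
    have "distinct l"
      by (simp add: l_def eq_diff_iff \<sigma>_range inj_eq[OF permutes_inj[OF \<sigma>]]
          del: One_nat_def)
    moreover have "set l \<subseteq> {0..3}"
      using \<sigma>_range[of 1] \<sigma>_range[of 2] \<sigma>_range[of 3] \<sigma>_range[of 4]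
      by (simp add: l_def) linarith
    ultimately have "l \<in> permutations_of_set {0..3}"
      by (intro permutation_0123I) (simp_all add: l_def)
    moreover have "f = word_poly [l]"
      by (simp add: f l_def var_eq word_poly_mult)
    ultimately show "f \<in> ?B"
      by blast
  next
    fix f :: "(nat, 'f) free_algebra"
    assume "f \<in> ?B"
    then obtain l where f: "f = word_poly [l]" and l: "distinct l" "set l = {0..3}"
      by (auto simp: permutations_of_set_def)
    have len: "length l = 4"
      using distinct_card[OF l(1)] l(2) by simp
    \<comment> \<open>Inverse of the passage to lists: the shifts convert between counting from 0
      and from 1, and \<open>permutes\<close> demands the identity outside 1..4.\<close>
    define \<sigma> where "\<sigma> i = (if i \<in> {1..4} then Suc (l ! (i - 1)) else i)" for i
    have "bij_betw (\<lambda>i. i - 1) {1..4} {0..<4::nat}"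
      by (rule bij_betwI[where g = Suc]) auto
    moreover have "bij_betw ((!) l) {0..<4} {0..3}"
      using l len by (intro bij_betw_nth) auto
    moreover have "bij_betw Suc {0..3} {1..4}"
      by (rule bij_betwI[where g = "\<lambda>i. i - 1"]) auto
    ultimately have "bij_betw (Suc \<circ> ((!) l \<circ> (\<lambda>i. i - 1))) {1..4} {1..4}"
      by (intro bij_betw_trans)
    also have "?this \<longleftrightarrow> bij_betw \<sigma> {1..4} {1..4}"
      by (rule bij_betw_cong) (auto simp: \<sigma>_def)
    finally have "bij_betw \<sigma> {1..4} {1..4}" .
    then have "\<sigma> permutes {1..4}"
      by (rule bij_imp_permutes) (simp add: \<sigma>_def del: atLeastAtMost_iff)
    moreover obtain i j k m where "l = [i, j, k, m]"
      using len by (auto simp: length_Suc_conv eval_nat_numeral)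
    then have "f = var (\<sigma> 1) * var (\<sigma> 2) * var (\<sigma> 3) * var (\<sigma> 4)"
      by (simp add: f var_eq word_poly_mult \<sigma>_def eval_nat_numeral)
    ultimately show "f \<in> ?A"
      by blast
  qed
  then show ?thesis
    by (simp add: multidegree_1111_def)
qed

lemma keys_multidegree_1111:
  assumes "f \<in> multidegree_1111"
  shows "Poly_Mapping.keys f \<subseteq> Word ` permutations_of_set {0..3}"
  using assms unfolding multidegree_1111_eq
proof (induction rule: free.span_induct_alt)
  case base
  then show ?case by simp
next
  case (step c f g)
  then obtain l where "l \<in> permutations_of_set {0..3}" "f = word_poly [l]"
    by auto
  with step.IH show ?case
    by (auto simp: in_keys_iff lookup_add word_poly_def lookup_single when_def subset_iff
        split: if_splits)
qed

lemma word_poly_in_multidegree_1111: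
  "set ls \<subseteq> permutations_of_set {0..3} \<Longrightarrow> word_poly ls \<in> multidegree_1111"
  unfolding multidegree_1111_eq
proof (induction ls)
  case Nil
  then show ?case by (simp add: word_poly_def free.span_zero)
next
  case (Cons l ls)
  then show ?case
    by (subst word_poly_Cons) (auto intro!: free.span_add intro: free.span_base)
qed


section \<open>The basis of identities\<close>

definition identity_basis :: "(nat, 'f::field) free_algebra list"
  where "identity_basis =
    [Gamma_poly, Psi_poly, Delta_poly, Lambda_poly,
     x1 * St3 x2 x3 x4, x2 * St3 x1 x3 x4, x3 * St3 x1 x2 x4, x4 * St3 x1 x2 x3,
     St3 x2 x3 x4 * x1, St3 x1 x3 x4 * x2, St3 x1 x2 x4 * x3,
     commutator (commutator x1 x3) (commutator x2 x4)]"

text \<open>The supports of the basis elements modulo 2.\<close>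

definition basis_words :: "nat list list list"
  where "basis_words =
   [[[0, 1, 2, 3], [0, 2, 3, 1], [1, 2, 3, 0], [1, 3, 0, 2], [2, 0, 1, 3], [2, 3, 0, 1],
      [3, 0, 1, 2], [3, 1, 2, 0]],
    [[1, 0, 3, 2], [1, 3, 0, 2], [2, 0, 3, 1], [2, 3, 0, 1]],
    [[1, 0, 2, 3], [1, 3, 0, 2], [2, 0, 1, 3], [2, 3, 0, 1], [3, 0, 1, 2], [3, 0, 2, 1]],
    [[0, 1, 2, 3], [0, 1, 3, 2], [1, 0, 2, 3], [1, 0, 3, 2], [2, 0, 3, 1], [2, 1, 3, 0],
      [3, 0, 2, 1], [3, 1, 2, 0]],
    [[0, 1, 2, 3], [0, 1, 3, 2], [0, 2, 1, 3], [0, 2, 3, 1], [0, 3, 1, 2], [0, 3, 2, 1]],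
    [[1, 0, 2, 3], [1, 0, 3, 2], [1, 2, 0, 3], [1, 2, 3, 0], [1, 3, 0, 2], [1, 3, 2, 0]],
    [[2, 0, 1, 3], [2, 0, 3, 1], [2, 1, 0, 3], [2, 1, 3, 0], [2, 3, 0, 1], [2, 3, 1, 0]],
    [[3, 0, 1, 2], [3, 0, 2, 1], [3, 1, 0, 2], [3, 1, 2, 0], [3, 2, 0, 1], [3, 2, 1, 0]],
    [[1, 2, 3, 0], [1, 3, 2, 0], [2, 1, 3, 0], [2, 3, 1, 0], [3, 1, 2, 0], [3, 2, 1, 0]],
    [[0, 2, 3, 1], [0, 3, 2, 1], [2, 0, 3, 1], [2, 3, 0, 1], [3, 0, 2, 1], [3, 2, 0, 1]],
    [[0, 1, 3, 2], [0, 3, 1, 2], [1, 0, 3, 2], [1, 3, 0, 2], [3, 0, 1, 2], [3, 1, 0, 2]],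
    [[0, 2, 1, 3], [0, 2, 3, 1], [1, 3, 0, 2], [1, 3, 2, 0], [2, 0, 1, 3], [2, 0, 3, 1],
      [3, 1, 0, 2], [3, 1, 2, 0]]]"

text \<open>
  Sets of words whose coefficient sums form a dual family for the basis. Such functionals are
  determined only up to the linear conditions satisfied by the identities; these were chosen with
  as few words as possible.
\<close>

definition dual_words :: "nat list list list"
  where "dual_words =
   [[[0, 2, 3, 1], [0, 3, 1, 2], [3, 1, 0, 2], [3, 2, 0, 1]],
    [[1, 3, 0, 2], [1, 3, 2, 0], [3, 0, 1, 2], [3, 2, 1, 0]],
    [[2, 0, 3, 1], [2, 3, 0, 1], [3, 1, 2, 0], [3, 2, 1, 0]],
    [[2, 1, 3, 0], [2, 3, 1, 0]],
    [[0, 3, 2, 1], [2, 1, 0, 3], [2, 3, 1, 0], [3, 2, 0, 1], [3, 2, 1, 0]],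
    [[1, 2, 0, 3]],
    [[2, 1, 0, 3]],
    [[2, 1, 0, 3], [2, 3, 1, 0], [3, 2, 1, 0]],
    [[2, 1, 0, 3], [2, 3, 1, 0]],
    [[2, 1, 0, 3], [2, 3, 1, 0], [3, 2, 0, 1], [3, 2, 1, 0]],
    [[1, 2, 0, 3], [1, 3, 2, 0], [3, 1, 0, 2], [3, 2, 1, 0]],
    [[0, 3, 1, 2], [0, 3, 2, 1], [3, 1, 0, 2], [3, 2, 0, 1]]]"

text \<open>Multiplying out gives combinations of words; modulo 2 the even coefficients vanish and
  the odd ones, of either sign, become 1.\<close>

lemma identity_basis_eq:
  assumes "(2::'f::field) = 0"
  shows "(identity_basis :: (nat, 'f) free_algebra list) = map word_poly basis_words"
proof -
  note char2 = char2_ring[OF two_eq_zero_free_algebra[OF assms]]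
  \<comment> \<open>Restricted to lists of at least two words: on singletons the general rule would
    rewrite forever.\<close>
  have Cons: "word_poly (l # m # ls) =
      word_poly [l] + (word_poly (m # ls) :: (nat, 'f) free_algebra)"
    for l m ls
    by (rule word_poly_Cons)
  show ?thesis
    by (simp add: identity_basis_def basis_words_def Gamma_poly_def Psi_poly_def Delta_poly_def
        Lambda_poly_def commutator_def St3_char2[OF two_eq_zero_free_algebra[OF assms]]
        var_eq word_poly_mult Cons distrib_left distrib_right char2 ac_simps)
qed

section \<open>The basis elements are identities of multidegree (1,1,1,1)\<close>

lemma basis_words_permutations:
  "ls \<in> set basis_words \<Longrightarrow> set ls \<subseteq> permutations_of_set {0..3}"
  unfolding permutations_of_set_0123 by (auto simp: basis_words_def perm_words_def)

lemma polynomial_identity_basis_words: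
  assumes "(2::'f::field) = 0" and "ls \<in> set basis_words"
  shows "weyl.polynomial_identity (weyl_minus_1 :: 'f weyl set) (word_poly ls)"
  unfolding weyl.polynomial_identity_def
proof (intro allI impI)
  fix a :: "nat \<Rightarrow> 'f weyl"
  assume "\<forall>v. a v \<in> weyl_minus_1"
  then have "\<forall>v. \<exists>p. a v = weyl_of_poly p * weyl_y"
    by (auto simp: weyl_minus_1_eq)
  then obtain p where a: "a = (\<lambda>v. weyl_of_poly (p v) * weyl_y)"
    by metis
  note char2 = char2_ring[OF two_eq_zero_poly[OF assms(1)]]
  define g where "g l = prod_list (map a l)" for l
  note g = weyl_product_char2[OF assms(1), of p, folded a g_def]
  have "weyl.eval a (word_poly ls) = sum_list (map g ls)"
    by (simp add: weyl.eval_word_poly g_def[abs_def])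
  \<comment> \<open>In each coefficient of the summed normal forms, every monomial in the
    \<open>p v\<close> and their derivatives occurs an even number of times.\<close>
  also have "\<dots> = 0"
    using assms(2) unfolding basis_words_def
    by (auto simp: g weyl4_add weyl4_eq_0_iff char2 distrib_left mult_ac add_ac)
  finally show "weyl.eval a (word_poly ls) = 0" .
qed

section \<open>Linear conditions on the coefficients of an identity\<close>

text \<open>Substitute x y for the variables in \<open>S\<close> and y for the others. At 0 the
  polynomial x has value 0 and derivative 1, the polynomial 1 has value 1 and derivative 0; so
  \<open>e\<close> records values and \<open>d\<close> derivatives, and the conclusions are the
  constant terms of the coefficients of y^4, y^3, y^2 and y.\<close>

lemma identity_coeffs:
  fixes f :: "(nat, 'f::field) free_algebra" and S :: "nat set"
  assumes two: "(2::'f) = 0" and f: "f \<in> multidegree_1111"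
    and id: "weyl.polynomial_identity (weyl_minus_1 :: 'f weyl set) f"
  defines "e \<equiv> \<lambda>l i. of_bool (l ! i \<notin> S)" and "d \<equiv> \<lambda>l i. of_bool (l ! i \<in> S)"
    and "c \<equiv> \<lambda>l. Poly_Mapping.lookup f (Word l)"
  shows "(\<Sum>l\<leftarrow>perm_words. c l * (e l 0 * e l 1 * e l 2 * e l 3)) = 0"
    and "(\<Sum>l\<leftarrow>perm_words. c l * (e l 0 * (d l 1 * e l 2 * e l 3 + e l 1 * e l 2 * d l 3))) = 0"
    and "(\<Sum>l\<leftarrow>perm_words. c l * (e l 0 * d l 1 * d l 2 * e l 3)) = 0"
    and "(\<Sum>l\<leftarrow>perm_words. c l * (e l 0 * d l 1 * d l 2 * d l 3)) = 0"
proof -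
  define p :: "nat \<Rightarrow> 'f poly" where "p i = (if i \<in> S then [:0, 1:] else 1)" for i
  define a where "a v = weyl_of_poly (p v) * weyl_y" for v
  let ?P = "permutations_of_set {0..3::nat}"
  define q4 where "q4 l = p (l ! 0) * p (l ! 1) * p (l ! 2) * p (l ! 3)" for l
  define q3 where "q3 l = p (l ! 0) * (pderiv (p (l ! 1)) * p (l ! 2) * p (l ! 3)
    + p (l ! 1) * p (l ! 2) * pderiv (p (l ! 3)))" for l
  define q2 where "q2 l = p (l ! 0) * pderiv (p (l ! 1)) * pderiv (p (l ! 2)) * p (l ! 3)" for l
  define q1 where
    "q1 l = p (l ! 0) * pderiv (p (l ! 1)) * pderiv (p (l ! 2)) * pderiv (p (l ! 3))" for l
  note q_defs = q4_def q3_def q2_def q1_def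
  have word: "prod_list (map a l) = weyl4 (q4 l) (q3 l) (q2 l) (q1 l)" if "l \<in> ?P" for l
  proof -
    have "length l = 4"
      using length_finite_permutations_of_set[OF that] by simp
    then obtain i j k m where "l = [i, j, k, m]"
      by (auto simp: length_Suc_conv eval_nat_numeral)
    then show ?thesis
      unfolding a_def q_defs using weyl_product_char2[OF two, of p i j k m]
      by (simp add: eval_nat_numeral)
  qed
  have "weyl.eval a f = (\<Sum>w\<in>Word ` ?P.
      weyl_scale (Poly_Mapping.lookup f w) (prod_list (map a (letters w))))"
    using keys_multidegree_1111[OF f] by (intro weyl.eval_superset) auto
  also have "\<dots> = (\<Sum>l\<in>?P. weyl_scale (c l) (prod_list (map a l)))"
    by (subst sum.reindex) (auto simp: inj_on_def c_def)
  finally have "weyl.eval a f = (\<Sum>l\<in>?P. weyl_scale (c l) (prod_list (map a l)))" .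
  moreover have "weyl.eval a f = 0"
    using id by (auto simp: weyl.polynomial_identity_def weyl_minus_1_eq a_def)
  ultimately have zero: "(\<Sum>l\<in>?P. weyl_scale (c l) (prod_list (map a l))) = 0"
    by simp
  have e: "poly (p (l ! i)) 0 = e l i" and d: "poly (pderiv (p (l ! i))) 0 = d l i" for l i
    by (simp_all add: p_def e_def d_def pderiv_pCons)
  have "weyl4 (\<Sum>l\<in>?P. smult (c l) (q4 l)) (\<Sum>l\<in>?P. smult (c l) (q3 l))
      (\<Sum>l\<in>?P. smult (c l) (q2 l)) (\<Sum>l\<in>?P. smult (c l) (q1 l)) = 0"
    using zero by (simp add: word weyl_scale_weyl4 sum_weyl4)
  then have "poly (\<Sum>l\<in>?P. smult (c l) (q4 l)) 0 = 0" "poly (\<Sum>l\<in>?P. smult (c l) (q3 l)) 0 = 0"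
    "poly (\<Sum>l\<in>?P. smult (c l) (q2 l)) 0 = 0" "poly (\<Sum>l\<in>?P. smult (c l) (q1 l)) 0 = 0"
    by (simp_all add: weyl4_eq_0_iff)
  then show "(\<Sum>l\<leftarrow>perm_words. c l * (e l 0 * e l 1 * e l 2 * e l 3)) = 0"
    and "(\<Sum>l\<leftarrow>perm_words. c l * (e l 0 * (d l 1 * e l 2 * e l 3 + e l 1 * e l 2 * d l 3))) = 0"
    and "(\<Sum>l\<leftarrow>perm_words. c l * (e l 0 * d l 1 * d l 2 * e l 3)) = 0"
    and "(\<Sum>l\<leftarrow>perm_words. c l * (e l 0 * d l 1 * d l 2 * d l 3)) = 0"
    by (simp_all only: q_defs poly_sum poly_smult poly_mult poly_add e d sum_perm_words[symmetric])
qed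

text \<open>Twelve conditions from substitutions and the twelve dual functionals form a 24 by 24
  linear system for the coefficients, which is invertible in characteristic 2.\<close>

lemma identity_eq_0:
  fixes f :: "(nat, 'f::field) free_algebra"
  assumes two: "(2::'f) = 0" and f: "f \<in> multidegree_1111"
    and id: "weyl.polynomial_identity (weyl_minus_1 :: 'f weyl set) f"
    and dual: "\<And>j. j < 12 \<Longrightarrow> (\<Sum>l\<leftarrow>dual_words ! j. Poly_Mapping.lookup f (Word l)) = 0"
  shows "f = 0"
proof -
  note coeffs = identity_coeffs[OF two f id]
  note char2 = char2_ring[OF two]
  define c where "c l = Poly_Mapping.lookup f (Word l)" for l
  \<comment> \<open>The digit after \<open>pos\<close> is the exponent of y whose coefficient is
    used. The digits after the underscore form the set \<open>S\<close>, except in the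
    \<open>pos1\<close> equations, where \<open>S\<close> is the complement of the digit and thus
    selects the words that start with it.\<close>
  have pos3_0: "c [1, 0, 2, 3] + c [1, 0, 3, 2] + c [1, 2, 3, 0] + c [1, 3, 2, 0] + c [2, 0, 1, 3] +
      c [2, 0, 3, 1] + c [2, 1, 3, 0] + c [2, 3, 1, 0] + c [3, 0, 1, 2] + c [3, 0, 2, 1] +
      c [3, 1, 2, 0] + c [3, 2, 1, 0] = 0"
    using coeffs(2)[of "{0}"] by (simp add: c_def perm_words_def ac_simps)
  have pos3_2: "c [0, 1, 3, 2] + c [0, 2, 1, 3] + c [0, 2, 3, 1] + c [0, 3, 1, 2] + c [1, 0, 3, 2] +
      c [1, 2, 0, 3] + c [1, 2, 3, 0] + c [1, 3, 0, 2] + c [3, 0, 1, 2] + c [3, 1, 0, 2] +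
      c [3, 2, 0, 1] + c [3, 2, 1, 0] = 0"
    using coeffs(2)[of "{2}"] by (simp add: c_def perm_words_def ac_simps)
  have pos3_3: "c [0, 1, 2, 3] + c [0, 2, 1, 3] + c [0, 3, 1, 2] + c [0, 3, 2, 1] + c [1, 0, 2, 3] +
      c [1, 2, 0, 3] + c [1, 3, 0, 2] + c [1, 3, 2, 0] + c [2, 0, 1, 3] + c [2, 1, 0, 3] +
      c [2, 3, 0, 1] + c [2, 3, 1, 0] = 0"
    using coeffs(2)[of "{3}"] by (simp add: c_def perm_words_def ac_simps)
  have pos2_01: "c [2, 0, 1, 3] + c [2, 1, 0, 3] + c [3, 0, 1, 2] + c [3, 1, 0, 2] = 0"
    using coeffs(3)[of "{0, 1}"] by (simp add: c_def perm_words_def ac_simps)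
  have pos2_02: "c [1, 0, 2, 3] + c [1, 2, 0, 3] + c [3, 0, 2, 1] + c [3, 2, 0, 1] = 0"
    using coeffs(3)[of "{0, 2}"] by (simp add: c_def perm_words_def ac_simps)
  have pos2_03: "c [1, 0, 3, 2] + c [1, 3, 0, 2] + c [2, 0, 3, 1] + c [2, 3, 0, 1] = 0"
    using coeffs(3)[of "{0, 3}"] by (simp add: c_def perm_words_def ac_simps)
  have pos2_12: "c [0, 1, 2, 3] + c [0, 2, 1, 3] + c [3, 1, 2, 0] + c [3, 2, 1, 0] = 0"
    using coeffs(3)[of "{1, 2}"] by (simp add: c_def perm_words_def ac_simps)
  have pos2_13: "c [0, 1, 3, 2] + c [0, 3, 1, 2] + c [2, 1, 3, 0] + c [2, 3, 1, 0] = 0"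
    using coeffs(3)[of "{1, 3}"] by (simp add: c_def perm_words_def ac_simps)
  have pos1_0: "c [0, 1, 2, 3] + c [0, 1, 3, 2] + c [0, 2, 1, 3] + c [0, 2, 3, 1] + c [0, 3, 1, 2] +
      c [0, 3, 2, 1] = 0"
    using coeffs(4)[of "{1, 2, 3}"] by (simp add: c_def perm_words_def ac_simps)
  have pos1_1: "c [1, 0, 2, 3] + c [1, 0, 3, 2] + c [1, 2, 0, 3] + c [1, 2, 3, 0] + c [1, 3, 0, 2] +
      c [1, 3, 2, 0] = 0"
    using coeffs(4)[of "{0, 2, 3}"] by (simp add: c_def perm_words_def ac_simps)
  have pos1_2: "c [2, 0, 1, 3] + c [2, 0, 3, 1] + c [2, 1, 0, 3] + c [2, 1, 3, 0] + c [2, 3, 0, 1] +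
      c [2, 3, 1, 0] = 0"
    using coeffs(4)[of "{0, 1, 3}"] by (simp add: c_def perm_words_def ac_simps)
  have pos1_3: "c [3, 0, 1, 2] + c [3, 0, 2, 1] + c [3, 1, 0, 2] + c [3, 1, 2, 0] + c [3, 2, 0, 1] +
      c [3, 2, 1, 0] = 0"
    using coeffs(4)[of "{0, 1, 2}"] by (simp add: c_def perm_words_def ac_simps)
  have d0: "c [0, 2, 3, 1] + c [0, 3, 1, 2] + c [3, 1, 0, 2] + c [3, 2, 0, 1] = 0"
    using dual[of 0] by (simp add: c_def dual_words_def ac_simps)
  have d1: "c [1, 3, 0, 2] + c [1, 3, 2, 0] + c [3, 0, 1, 2] + c [3, 2, 1, 0] = 0"
    using dual[of 1] by (simp add: c_def dual_words_def ac_simps)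
  have d2: "c [2, 0, 3, 1] + c [2, 3, 0, 1] + c [3, 1, 2, 0] + c [3, 2, 1, 0] = 0"
    using dual[of 2] by (simp add: c_def dual_words_def ac_simps)
  have d3: "c [2, 1, 3, 0] + c [2, 3, 1, 0] = 0"
    using dual[of 3] by (simp add: c_def dual_words_def ac_simps)
  have d4: "c [0, 3, 2, 1] + c [2, 1, 0, 3] + c [2, 3, 1, 0] + c [3, 2, 0, 1] + c [3, 2, 1, 0] = 0"
    using dual[of 4] by (simp add: c_def dual_words_def ac_simps)
  have d5: "c [1, 2, 0, 3] = 0"
    using dual[of 5] by (simp add: c_def dual_words_def ac_simps)
  have d6: "c [2, 1, 0, 3] = 0"
    using dual[of 6] by (simp add: c_def dual_words_def ac_simps)
  have d7: "c [2, 1, 0, 3] + c [2, 3, 1, 0] + c [3, 2, 1, 0] = 0"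
    using dual[of 7] by (simp add: c_def dual_words_def ac_simps)
  have d8: "c [2, 1, 0, 3] + c [2, 3, 1, 0] = 0"
    using dual[of 8] by (simp add: c_def dual_words_def ac_simps)
  have d9: "c [2, 1, 0, 3] + c [2, 3, 1, 0] + c [3, 2, 0, 1] + c [3, 2, 1, 0] = 0"
    using dual[of 9] by (simp add: c_def dual_words_def ac_simps)
  have d10: "c [1, 2, 0, 3] + c [1, 3, 2, 0] + c [3, 1, 0, 2] + c [3, 2, 1, 0] = 0"
    using dual[of 10] by (simp add: c_def dual_words_def ac_simps)
  have d11: "c [0, 3, 1, 2] + c [0, 3, 2, 1] + c [3, 1, 0, 2] + c [3, 2, 0, 1] = 0"
    using dual[of 11] by (simp add: c_def dual_words_def ac_simps)
  \<comment> \<open>Elimination modulo 2: a coefficient is the sum of the left-hand sides of several of these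
    equations, as all other coefficients cancel or are already known to vanish.\<close>
  have z2103: "c [2, 1, 0, 3] = 0"
    using d6 by simp
  have z2310: "c [2, 3, 1, 0] = 0"
    using d8 z2103 by simp
  have z3210: "c [3, 2, 1, 0] = 0"
    using d7 z2103 z2310 by simp
  have z3201: "c [3, 2, 0, 1] = 0"
    using d9 z2103 z2310 z3210 by simp
  have z1203: "c [1, 2, 0, 3] = 0"
    using d5 by simp
  have z0321: "c [0, 3, 2, 1] = 0"
    using d4 z2103 z2310 z3201 z3210 by simp
  have z2130: "c [2, 1, 3, 0] = 0"
    using d3 z2310 by simp
  have e: "c [0, 2, 3, 1] + c [0, 3, 2, 1] =
      (c [0, 3, 1, 2] + c [0, 3, 2, 1] + c [3, 1, 0, 2] + c [3, 2, 0, 1]) +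
      (c [0, 2, 3, 1] + c [0, 3, 1, 2] + c [3, 1, 0, 2] + c [3, 2, 0, 1])"
    by (simp only: char2 add_0_left add_0_right ac_simps)
  have z0231: "c [0, 2, 3, 1] = 0"
    \<comment> \<open>The right-hand side of \<open>e\<close> repeats the left-hand sides of
      \<open>d11\<close> and \<open>d0\<close> literally, so that unfolding replaces each group by
      0.\<close>
    using e[unfolded d11 d0] z0321 by simp
  have e: "c [3, 1, 2, 0] + c [0, 2, 3, 1] + c [0, 3, 2, 1] + c [2, 1, 3, 0] + c [2, 3, 1, 0] +
      c [3, 2, 1, 0] =
      (c [0, 1, 2, 3] + c [0, 1, 3, 2] + c [0, 2, 1, 3] + c [0, 2, 3, 1] + c [0, 3, 1, 2] +
       c [0, 3, 2, 1]) +
      (c [0, 1, 3, 2] + c [0, 3, 1, 2] + c [2, 1, 3, 0] + c [2, 3, 1, 0]) +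
      (c [0, 1, 2, 3] + c [0, 2, 1, 3] + c [3, 1, 2, 0] + c [3, 2, 1, 0])"
    by (simp only: char2 add_0_left add_0_right ac_simps)
  have z3120: "c [3, 1, 2, 0] = 0"
    using e[unfolded pos1_0 pos2_13 pos2_12] z0231 z0321 z2130 z2310 z3210 by simp
  have e: "c [2, 0, 1, 3] + c [2, 1, 0, 3] + c [2, 1, 3, 0] + c [2, 3, 1, 0] + c [3, 1, 2, 0] +
      c [3, 2, 1, 0] =
      (c [2, 0, 3, 1] + c [2, 3, 0, 1] + c [3, 1, 2, 0] + c [3, 2, 1, 0]) +
      (c [2, 0, 1, 3] + c [2, 0, 3, 1] + c [2, 1, 0, 3] + c [2, 1, 3, 0] + c [2, 3, 0, 1] +
       c [2, 3, 1, 0])"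
    by (simp only: char2 add_0_left add_0_right ac_simps)
  have z2013: "c [2, 0, 1, 3] = 0"
    using e[unfolded d2 pos1_2] z2103 z2130 z2310 z3120 z3210 by simp
  have e: "c [3, 0, 2, 1] + c [2, 0, 1, 3] + c [2, 1, 0, 3] + c [3, 1, 2, 0] + c [3, 2, 0, 1] +
      c [3, 2, 1, 0] =
      (c [3, 0, 1, 2] + c [3, 0, 2, 1] + c [3, 1, 0, 2] + c [3, 1, 2, 0] + c [3, 2, 0, 1] +
       c [3, 2, 1, 0]) +
      (c [2, 0, 1, 3] + c [2, 1, 0, 3] + c [3, 0, 1, 2] + c [3, 1, 0, 2])"
    by (simp only: char2 add_0_left add_0_right ac_simps)
  have z3021: "c [3, 0, 2, 1] = 0"
    using e[unfolded pos1_3 pos2_01] z2013 z2103 z3120 z3201 z3210 by simp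
  have z1023: "c [1, 0, 2, 3] = 0"
    using pos2_02 z1203 z3021 z3201 by simp
  have e: "c [1, 3, 0, 2] + c [1, 2, 0, 3] + c [3, 0, 2, 1] + c [3, 1, 2, 0] + c [3, 2, 0, 1] +
      c [3, 2, 1, 0] =
      (c [1, 2, 0, 3] + c [1, 3, 2, 0] + c [3, 1, 0, 2] + c [3, 2, 1, 0]) +
      (c [1, 3, 0, 2] + c [1, 3, 2, 0] + c [3, 0, 1, 2] + c [3, 2, 1, 0]) +
      (c [3, 0, 1, 2] + c [3, 0, 2, 1] + c [3, 1, 0, 2] + c [3, 1, 2, 0] + c [3, 2, 0, 1] +
       c [3, 2, 1, 0])"
    by (simp only: char2 add_0_left add_0_right ac_simps)
  have z1302: "c [1, 3, 0, 2] = 0"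
    using e[unfolded d10 d1 pos1_3] z1203 z3021 z3120 z3201 z3210 by simp
  have e: "c [1, 0, 3, 2] + c [1, 3, 0, 2] + c [3, 1, 2, 0] + c [3, 2, 1, 0] =
      (c [2, 0, 3, 1] + c [2, 3, 0, 1] + c [3, 1, 2, 0] + c [3, 2, 1, 0]) +
      (c [1, 0, 3, 2] + c [1, 3, 0, 2] + c [2, 0, 3, 1] + c [2, 3, 0, 1])"
    by (simp only: char2 add_0_left add_0_right ac_simps)
  have z1032: "c [1, 0, 3, 2] = 0"
    using e[unfolded d2 pos2_03] z1302 z3120 z3210 by simp
  have e: "c [2, 3, 0, 1] + c [1, 0, 2, 3] + c [1, 3, 0, 2] + c [2, 0, 1, 3] + c [2, 1, 0, 3] +
      c [2, 3, 1, 0] + c [3, 1, 2, 0] + c [3, 2, 0, 1] =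
      (c [0, 3, 1, 2] + c [0, 3, 2, 1] + c [3, 1, 0, 2] + c [3, 2, 0, 1]) +
      (c [1, 2, 0, 3] + c [1, 3, 2, 0] + c [3, 1, 0, 2] + c [3, 2, 1, 0]) +
      (c [0, 1, 2, 3] + c [0, 2, 1, 3] + c [3, 1, 2, 0] + c [3, 2, 1, 0]) +
      (c [0, 1, 2, 3] + c [0, 2, 1, 3] + c [0, 3, 1, 2] + c [0, 3, 2, 1] + c [1, 0, 2, 3] +
       c [1, 2, 0, 3] + c [1, 3, 0, 2] + c [1, 3, 2, 0] + c [2, 0, 1, 3] + c [2, 1, 0, 3] +
       c [2, 3, 0, 1] + c [2, 3, 1, 0])"
    by (simp only: char2 add_0_left add_0_right ac_simps)
  have z2301: "c [2, 3, 0, 1] = 0"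
    using e[unfolded d11 d10 pos2_12 pos3_3] z1023 z1302 z2013 z2103 z2310 z3120 z3201 by simp
  have z2031: "c [2, 0, 3, 1] = 0"
    using d2 z2301 z3120 z3210 by simp
  have e: "c [1, 2, 3, 0] + c [1, 0, 2, 3] + c [1, 0, 3, 2] + c [1, 3, 0, 2] + c [2, 0, 1, 3] +
      c [2, 0, 3, 1] + c [2, 1, 3, 0] + c [2, 3, 1, 0] + c [3, 0, 2, 1] + c [3, 1, 2, 0] =
      (c [1, 3, 0, 2] + c [1, 3, 2, 0] + c [3, 0, 1, 2] + c [3, 2, 1, 0]) +
      (c [1, 0, 2, 3] + c [1, 0, 3, 2] + c [1, 2, 3, 0] + c [1, 3, 2, 0] + c [2, 0, 1, 3] +
       c [2, 0, 3, 1] + c [2, 1, 3, 0] + c [2, 3, 1, 0] + c [3, 0, 1, 2] + c [3, 0, 2, 1] +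
       c [3, 1, 2, 0] + c [3, 2, 1, 0])"
    by (simp only: char2 add_0_left add_0_right ac_simps)
  have z1230: "c [1, 2, 3, 0] = 0"
    using e[unfolded d1 pos3_0] z1023 z1032 z1302 z2013 z2031 z2130 z2310 z3021 z3120 by simp
  have z1320: "c [1, 3, 2, 0] = 0"
    using pos1_1 z1023 z1032 z1203 z1230 z1302 by simp
  have z3102: "c [3, 1, 0, 2] = 0"
    using d10 z1203 z1320 z3210 by simp
  have z0312: "c [0, 3, 1, 2] = 0"
    using d11 z0321 z3102 z3201 by simp
  have z3012: "c [3, 0, 1, 2] = 0"
    using d1 z1302 z1320 z3210 by simp
  have z0132: "c [0, 1, 3, 2] = 0"
    using pos2_13 z0312 z2130 z2310 by simp
  have z0213: "c [0, 2, 1, 3] = 0"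
    using pos3_2 z0132 z0231 z0312 z1032 z1203 z1230 z1302 z3012 z3102 z3201 z3210 by simp
  have z0123: "c [0, 1, 2, 3] = 0"
    using pos1_0 z0132 z0213 z0231 z0312 z0321 by simp
  have zero: "\<forall>l\<in>set perm_words. c l = 0"
    using z2103 z2310 z3210 z3201 z1203 z0321 z2130 z0231 z3120 z2013 z3021 z1023
      z1302 z1032 z2301 z2031 z1230 z1320 z3102 z0312 z3012 z0132 z0213 z0123
    by (simp add: perm_words_def)
  have "w \<notin> Poly_Mapping.keys f" for w
  proof
    assume w: "w \<in> Poly_Mapping.keys f"
    then obtain l where "w = Word l" "l \<in> set perm_words"
      using keys_multidegree_1111[OF f] permutations_of_set_0123 by blast
    then show False
      using zero w by (simp add: c_def in_keys_iff)
  qed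
  then have "Poly_Mapping.keys f = {}"
    by blast
  then show ?thesis
    by simp
qed

section \<open>Duality and the basis property\<close>

text \<open>A coefficient sum of a polynomial with coefficients 0 and 1 counts common words, so in
  characteristic 2 the pairing of functionals with basis elements depends on parities only. They
  form the identity matrix, by finite computation.\<close>

lemma dual_words_parity:
  "\<forall>i\<in>{0..<12}. \<forall>j\<in>{0..<12}.
    odd (length (filter (\<lambda>l. l \<in> set (basis_words ! i)) (dual_words ! j))) \<longleftrightarrow> i = j"
  by code_simp

theorem proposition4p4:
  assumes "infinite (UNIV :: 'f::field set)"
    and "CHAR('f) = 2"
  shows "free.is_basis_of
    [Gamma_poly, Psi_poly, Delta_poly, Lambda_poly,
     x1 * St3 x2 x3 x4, x2 * St3 x1 x3 x4, x3 * St3 x1 x2 x4, x4 * St3 x1 x2 x3,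
     St3 x2 x3 x4 * x1, St3 x1 x3 x4 * x2, St3 x1 x2 x4 * x3,
     commutator (commutator x1 x3) (commutator x2 x4)]
    {f \<in> multidegree_1111. weyl.polynomial_identity (weyl_minus_1 :: 'f weyl set) f}"
proof -
  have two: "(2::'f) = 0"
    using assms(2) by (rule two_eq_zero)
  let ?U = "{f \<in> multidegree_1111. weyl.polynomial_identity (weyl_minus_1 :: 'f weyl set) f}"
  let ?L = "\<lambda>j f. \<Sum>l\<leftarrow>dual_words ! j. Poly_Mapping.lookup f (Word l) :: 'f"
  have len: "length basis_words = 12"
    by (simp add: basis_words_def)
  have distinct: "\<forall>ls\<in>set basis_words. distinct ls"
    by (simp add: basis_words_def)
  \<comment> \<open>The sum counts common words, and the image of a natural number in the field is
    determined by its parity.\<close>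
  have parity: "(\<Sum>l\<leftarrow>dual_words ! j. of_bool (l \<in> set (basis_words ! i))) = (of_bool (i = j) :: 'f)"
    if "i < 12" "j < 12" for i j
  proof -
    have "(\<Sum>l\<leftarrow>ls. of_bool (l \<in> A)) = (of_nat (length (filter (\<lambda>l. l \<in> A) ls)) :: 'f)"
      for ls and A :: "nat list set"
      by (induction ls) simp_all
    moreover have "of_nat n = (of_bool (odd n) :: 'f)" for n
      by (induction n) (simp_all add: char2_ring[OF two])
    ultimately show ?thesis
      using dual_words_parity that by simp
  qed
  \<comment> \<open>In characteristic 2 the stated list equals
    \<open>map word_poly basis_words\<close>, whose supports are explicit and can be paired with the
    functionals \<open>?L j\<close>.\<close>
  have "free.is_basis_of (map word_poly basis_words) ?U"
  proof (rule free.is_basis_of_dual[where L = ?L])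
    have "free.subspace (multidegree_1111 \<inter>
        {f. weyl.polynomial_identity (weyl_minus_1 :: 'f weyl set) f})"
      unfolding multidegree_1111_def
      by (intro free.subspace_inter free.subspace_span weyl.subspace_polynomial_identity)
    then show "free.subspace ?U"
      by (simp add: Int_def)
    show "set (map word_poly basis_words) \<subseteq> ?U"
      using polynomial_identity_basis_words[OF two] basis_words_permutations
      by (auto intro!: word_poly_in_multidegree_1111)
    show "?L j (f + g) = ?L j f + ?L j g" for j f g
      by (simp add: lookup_add sum_list_addf)
    show "?L j (free_scale c f) = c * ?L j f" for j c f
      by (simp add: sum_list_const_mult)
    show "?L j (map word_poly basis_words ! i) = of_bool (i = j)"
      if "i < length (map word_poly basis_words :: (nat, 'f) free_algebra list)"
        "j < length (map word_poly basis_words :: (nat, 'f) free_algebra list)" for i j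
      using that parity distinct by (simp add: len lookup_word_poly)
    show "u = 0" if "u \<in> ?U"
      "\<And>j. j < length (map word_poly basis_words :: (nat, 'f) free_algebra list) \<Longrightarrow> ?L j u = 0" for u
      using that identity_eq_0[OF two] by (simp add: len)
  qed
  then show ?thesis
    by (simp only: identity_basis_eq[OF two, symmetric] identity_basis_def)
qed

end
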